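(* Let $\hat\alpha:\mathbb N\to\mathbb N$ be a monotonically increasing function. Then LFTJ-$\Delta$ (Leapfrog Triejoin applied to the triangle query) runs in $O(m\,\hat\alpha(m)\log m)$ time on graphs with at most $m$ edges and arboricity of at most $\hat\alpha(m)$.
   Context: The arboricity $\alpha(G)$ of an undirected graph $G$ is the minimum number of edge-disjoint forests needed to cover the edges of $G$. "Monotonically increasing" is meant in the weak sense (nondecreasing). **Input.** A simple undirected graph $G$ is represented by its directed version $G^\star=(V,E)$, where for each edge $\{a,b\}$ of $G$, $E$ contains the pair $(\min\{a,b\},\max\{a,b\})$. **LFTJ-$\Delta$** is the in-memory Leapfrog Triejoin run on the query $T(x,y,z)\leftarrow E(x,y),E(x,z),E(y,z)$ with variable order $x,y,z$. With $V_1=\{u:(u,v)\in E\}$ and $D(v)=\{u:(v,u)\in E\}$ it performs: for each $a\in V_1\cap V_1$, for each $b\in V_1\cap D(a)$, for each $c\in D(a)\cap D(b)$, output $(a,b,c)$. Each intersection of sorted sets is computed by a leapfrog join: one iterator per set, repeatedly moving (by a "seek") the iterator with the smallest value to the least element that is at least the largest current iterator value, reporting a value whenever all iterators agree, and stopping when an iterator passes its end. Reading the current value and testing for the end take $O(1)$ time; in a set of size $N$ a seek or next takes $O(\log N)$ time, and amortized $O(1+\log(N/k))$ time if $k$ keys are visited. Consequently a leapfrog join of sets with smallest size $N_{\min}$ and largest size $N_{\max}$ takes time $O(N_{\min}\log(N_{\max}/N_{\min}))$. *)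

theory Defs
  imports Complex_Main
begin

section \<open>Undirected graphs and arboricity\<close>

definition simple_graph :: "'a set \<Rightarrow> 'a set set \<Rightarrow> bool" where
  "simple_graph V E \<longleftrightarrow> finite V \<and> (\<forall>e\<in>E. e \<subseteq> V \<and> card e = 2)"

definition is_cycle :: "'a set set \<Rightarrow> 'a list \<Rightarrow> bool" where
  "is_cycle F vs \<longleftrightarrow> 3 \<le> length vs \<and> distinct vs \<and>
     (\<forall>i<length vs. {vs ! i, vs ! (Suc i mod length vs)} \<in> F)"

definition forest :: "'a set set \<Rightarrow> bool" where
  "forest F \<longleftrightarrow> (\<nexists>vs. is_cycle F vs)"

definition arboricity :: "'a set set \<Rightarrow> nat" where
  "arboricity E = (LEAST k. \<exists>F :: nat \<Rightarrow> 'a set set.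
     (\<forall>i<k. forest (F i)) \<and>
     (\<forall>i<k. \<forall>j<k. i \<noteq> j \<longrightarrow> F i \<inter> F j = {}) \<and>
     (\<Union>i<k. F i) = E)"

definition directed :: "'a::linorder set set \<Rightarrow> ('a \<times> 'a) set" where
  "directed E = (\<lambda>e. (Min e, Max e)) ` E"


section \<open>Iterators over sorted sets\<close>

text \<open>
  \<open>keys\<close> lists the whole set in increasing order; \<open>rest\<close> is the suffix of \<open>keys\<close> that starts
  at the current position, so an empty \<open>rest\<close> means that the iterator has passed its end.
\<close>

datatype 'a iter = Iter (keys: "'a list") (rest: "'a list")

definition iter_open :: "'a::linorder set \<Rightarrow> 'a iter" where
  "iter_open S = Iter (sorted_list_of_set S) (sorted_list_of_set S)"

definition iter_size :: "'a iter \<Rightarrow> nat" where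
  "iter_size A = length (keys A)"

definition iter_at_end :: "'a iter \<Rightarrow> bool" where
  "iter_at_end A \<longleftrightarrow> rest A = []"

definition iter_key :: "'a iter \<Rightarrow> 'a" where
  "iter_key A = hd (rest A)"

definition iter_next :: "'a iter \<Rightarrow> 'a iter" where
  "iter_next A = Iter (keys A) (tl (rest A))"

definition iter_seek :: "'a::linorder iter \<Rightarrow> 'a \<Rightarrow> 'a iter" where
  "iter_seek A x = Iter (keys A) (dropWhile (\<lambda>y. y < x) (rest A))"


section \<open>Elementary operations and their costs\<close>

text \<open>
  A run is described by its results together with the list of elementary operations performed.
  Each operation records the iterator state it is applied to, so that a cost function may
  depend on the set, on the current position and on the target of a seek.
\<close>

datatype 'a oper =
    Open "'a iter"
  | At_End "'a iter"
  | Key "'a iter"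
  | Next "'a iter"
  | Seek "'a iter" 'a
  | Report 'a
  | Output "'a \<times> 'a \<times> 'a"

text \<open>
  The logarithmic bounds are written \<open>1 + log N\<close> because \<open>log N\<close> vanishes for \<open>N = 1\<close>
  (and, by the convention \<open>log 2 0 = 0\<close>, the bound is constant for \<open>N = 0\<close>). Opening an
  iterator is allowed the cost of a seek. Reporting a value and emitting a triple take constant
  time; they also pay for the bookkeeping of the surrounding loop.
\<close>

definition iterator_costs :: "('a oper \<Rightarrow> nat) \<Rightarrow> bool" where
  "iterator_costs cost \<longleftrightarrow> (\<exists>c::real.
     (\<forall>A. real (cost (At_End A)) \<le> c) \<and>
     (\<forall>A. real (cost (Key A)) \<le> c) \<and>
     (\<forall>x. real (cost (Report x)) \<le> c) \<and>
     (\<forall>t. real (cost (Output t)) \<le> c) \<and>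
     (\<forall>A. real (cost (Open A)) \<le> c * (1 + log 2 (real (iter_size A)))) \<and>
     (\<forall>A. real (cost (Next A)) \<le> c * (1 + log 2 (real (iter_size A)))) \<and>
     (\<forall>A x. real (cost (Seek A x)) \<le> c * (1 + log 2 (real (iter_size A)))))"

definition add_opers :: "'a oper list \<Rightarrow> 'b list \<times> 'a oper list \<Rightarrow> 'b list \<times> 'a oper list" where
  "add_opers os r = (fst r, os @ snd r)"

definition add_result :: "'b \<Rightarrow> 'b list \<times> 'a oper list \<Rightarrow> 'b list \<times> 'a oper list" where
  "add_result x r = (x # fst r, snd r)"


section \<open>Leapfrog join\<close>

text \<open>
  The iterators are kept in a cyclic order with increasing keys: the first one has the smallest
  key and the last one the largest, hence all of them agree as soon as the first key is not below
  the last one. An iterator that has been moved has the largest key and goes to the back.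
  Only the iterator moved last can have passed its end, so a single end test per move is
  recorded although the guard is phrased for all iterators.
\<close>

function leapfrog_search :: "'a::linorder iter list \<Rightarrow> 'a list \<times> 'a oper list" where
  "leapfrog_search its =
    (if its = [] \<or> (\<exists>A\<in>set its. iter_at_end A) then ([], [])
     else
       let A = hd its; B = last its; x = iter_key A; y = iter_key B in
       if x < y then
         let A' = iter_seek A y in
         add_opers [Key A, Key B, Seek A y, At_End A'] (leapfrog_search (tl its @ [A']))
       else
         let A' = iter_next A in
         add_opers [Key A, Key B, Report x, Next A, At_End A']
           (add_result x (leapfrog_search (tl its @ [A']))))"
  by pat_completeness auto
termination
proof (relation "measure (\<lambda>its. sum_list (map (\<lambda>A. length (rest A)) its))", goal_cases)
  case 1
  show ?case by simp
next
  case (2 its A B x y A')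
  from 2(1) have ne: "its \<noteq> []" and "hd its \<in> set its" by auto
  then have "rest A \<noteq> []" using 2(1,2) by (simp add: iter_at_end_def)
  then obtain z zs where r: "rest A = z # zs" by (cases "rest A") simp_all
  have its: "A # tl its = its" using ne 2(2) by simp
  have "rest A' = dropWhile (\<lambda>v. v < y) zs"
    using 2(4,6,7) r by (simp add: iter_key_def iter_seek_def)
  then have "length (rest A') < length (rest A)"
    using r length_dropWhile_le[of "\<lambda>v. v < y" zs] by simp
  then have "sum_list (map (\<lambda>A. length (rest A)) (tl its @ [A']))
      < sum_list (map (\<lambda>A. length (rest A)) (A # tl its))" by simp
  then show ?case unfolding its by simp
next
  case (3 its A B x y A')
  from 3(1) have ne: "its \<noteq> []" and "hd its \<in> set its" by auto
  then have "rest A \<noteq> []" using 3(1,2) by (simp add: iter_at_end_def)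
  moreover have "rest A' = tl (rest A)" using 3(7) by (simp add: iter_next_def)
  ultimately have "length (rest A') < length (rest A)" by (cases "rest A") simp_all
  then have "sum_list (map (\<lambda>A. length (rest A)) (tl its @ [A']))
      < sum_list (map (\<lambda>A. length (rest A)) (A # tl its))" by simp
  moreover have its: "A # tl its = its" using ne 3(2) by simp
  ultimately show ?case unfolding its by simp
qed

declare leapfrog_search.simps [simp del]

definition leapfrog_join :: "'a::linorder set list \<Rightarrow> 'a list \<times> 'a oper list" where
  "leapfrog_join Ss =
    (let its = map iter_open Ss in
     add_opers (map Open its @ map At_End its)
       (if \<exists>A\<in>set its. iter_at_end A then ([], [])
        else add_opers (map Key its) (leapfrog_search (sort_key iter_key its))))"


section \<open>Leapfrog Triejoin for the triangle query\<close>

definition sources :: "('a \<times> 'a) set \<Rightarrow> 'a set" where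
  "sources E = {u. \<exists>v. (u, v) \<in> E}"

definition successors :: "('a \<times> 'a) set \<Rightarrow> 'a \<Rightarrow> 'a set" where
  "successors E v = {u. (v, u) \<in> E}"

text \<open>
  In an actual run the operations of the loop body are interleaved with those producing the
  values looped over; listing the latter first does not change the total cost.
\<close>

definition for_each ::
    "'b list \<times> 'a oper list \<Rightarrow> ('b \<Rightarrow> 'c list \<times> 'a oper list) \<Rightarrow> 'c list \<times> 'a oper list" where
  "for_each r body =
    (concat (map (\<lambda>x. fst (body x)) (fst r)),
     snd r @ concat (map (\<lambda>x. snd (body x)) (fst r)))"

definition lftj_triangle :: "('a::linorder \<times> 'a) set \<Rightarrow> ('a \<times> 'a \<times> 'a) list \<times> 'a oper list" where
  "lftj_triangle E =
    for_each (leapfrog_join [sources E, sources E]) (\<lambda>a.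
      for_each (leapfrog_join [sources E, successors E a]) (\<lambda>b.
        for_each (leapfrog_join [successors E a, successors E b]) (\<lambda>c.
          ([(a, b, c)], [Output (a, b, c)]))))"

definition lftj_time :: "('a::linorder oper \<Rightarrow> nat) \<Rightarrow> ('a \<times> 'a) set \<Rightarrow> nat" where
  "lftj_time cost E = sum_list (map cost (snd (lftj_triangle E)))"

end

theory Submission
  imports Defs
begin

text \<open>
  Rooting each tree of a forest assigns to every edge its child endpoint, injectively. Hence
  for a weight \<open>d\<close> on the vertices the sum over the edges of the smaller endpoint weight is at
  most the total weight times the arboricity (Chiba and Nishizeki); with out-degrees as weights
  this is at most \<open>m \<alpha>\<close>. A leapfrog join of two sets moves its iterators alternately and every
  move consumes a key, so it performs a number of operations linear in the smaller size. The
  innermost joins run over the edges \<open>(a, b)\<close> and thus need \<open>O(m \<alpha>)\<close> operations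
  altogether, each of cost \<open>O(log m)\<close>.
\<close>

section \<open>Arboricity\<close>

definition simple_path :: "'a set set \<Rightarrow> 'a list \<Rightarrow> bool" where
  "simple_path F p \<longleftrightarrow> distinct p \<and> successively (\<lambda>x y. {x, y} \<in> F) p"

lemma forest_mono: "forest G \<Longrightarrow> F \<subseteq> G \<Longrightarrow> forest F"
  unfolding forest_def is_cycle_def by blast

text \<open>Bounds path lengths by the number of covered vertices, so that a longest path exists.
  The length condition excludes a lone vertex, which is a \<open>simple_path\<close> without lying
  on any edge.\<close>

lemma simple_path_subset:
  assumes "simple_path F p" and "2 \<le> length p"
  shows "set p \<subseteq> \<Union>F"
proof
  fix x assume "x \<in> set p"
  then obtain i where i: "i < length p" "x = p ! i" by (metis in_set_conv_nth)
  have edge: "{p ! j, p ! Suc j} \<in> F" if "Suc j < length p" for j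
    using assms(1) that by (auto simp: simple_path_def successively_conv_nth)
  show "x \<in> \<Union>F"
  proof (cases i)
    case 0
    with i edge[of 0] assms(2) show ?thesis by auto
  next
    case (Suc j)
    with i edge[of j] show ?thesis by auto
  qed
qed

text \<open>The edge back to the head closes the prefix ending at position \<open>j\<close>;
  \<open>2 \<le> j\<close> provides the three vertices that \<open>is_cycle\<close> demands.\<close>

lemma simple_path_closes_cycle:
  assumes "simple_path F p" and "j < length p" and "2 \<le> j" and "{p ! j, hd p} \<in> F"
  shows "is_cycle F (take (Suc j) p)"
proof -
  have "{take (Suc j) p ! i, take (Suc j) p ! (Suc i mod Suc j)} \<in> F" if "i < Suc j" for i
  proof (cases "i = j")
    case True
    with assms show ?thesis by (cases p) (auto simp: hd_conv_nth)
  next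
    case False
    with that assms(1,2) show ?thesis
      by (auto simp: simple_path_def successively_conv_nth)
  qed
  with assms show ?thesis by (simp add: is_cycle_def simple_path_def)
qed

text \<open>The first vertex of a longest path is a leaf: a second neighbour would either extend the
  path or close a cycle.\<close>

lemma forest_has_leaf:
  assumes "forest F" and "finite F" and "F \<noteq> {}" and card2: "\<And>e. e \<in> F \<Longrightarrow> card e = 2"
  obtains v e where "e \<in> F" and "v \<in> e" and "\<And>e'. e' \<in> F \<Longrightarrow> v \<in> e' \<Longrightarrow> e' = e"
proof -
  have fin: "finite (\<Union>F)"
    using assms(2) card2 by (metis card.infinite finite_Union zero_neq_numeral)
  obtain e0 where "e0 \<in> F" using assms(3) by blast
  with card2 obtain x0 y0 where e0: "{x0, y0} \<in> F" "x0 \<noteq> y0" by (metis card_2_iff)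
  let ?P = "\<lambda>p. simple_path F p \<and> 2 \<le> length p"
  have "?P [x0, y0]" using e0 by (simp add: simple_path_def)
  moreover have "length p < Suc (card (\<Union>F))" if "?P p" for p
    using that simple_path_subset[of F p] fin
    by (metis card_mono distinct_card less_Suc_eq_le simple_path_def)
  ultimately obtain p where p: "?P p" and max: "\<And>q. ?P q \<Longrightarrow> length q \<le> length p"
    using ex_has_greatest_nat[of ?P "[x0, y0]" length] by blast
  then obtain x y r where pe: "p = x # y # r"
    by (metis Suc_le_length_iff numeral_2_eq_2)
  have xy: "{x, y} \<in> F" using p by (simp add: pe simple_path_def)
  have "e' = {x, y}" if e': "e' \<in> F" "x \<in> e'" for e'
  proof (rule ccontr)
    assume ne: "e' \<noteq> {x, y}"
    obtain w where w: "e' = {x, w}" "w \<noteq> x"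
      using card2[OF e'(1)] e'(2) by (auto simp: card_2_iff)
    with ne have "w \<noteq> y" by auto
    show False
    proof (cases "w \<in> set p")
      case True
      then obtain j where j: "j < length p" "p ! j = w" by (metis in_set_conv_nth)
      \<comment> \<open>Positions 0 and 1 hold \<open>x\<close> and \<open>y\<close>, both different
        from \<open>w\<close>.\<close>
      have "2 \<le> j"
        using j \<open>w \<noteq> x\<close> \<open>w \<noteq> y\<close> pe by (cases j; cases "j - 1") auto
      moreover have "{p ! j, hd p} \<in> F" using j w e' pe by (simp add: insert_commute)
      ultimately show False
        using simple_path_closes_cycle[of F p j] p j assms(1) by (auto simp: forest_def)
    next
      case False
      with p w e' pe have "?P (w # p)"
        by (simp add: simple_path_def insert_commute)
      from max[OF this] show False by simp
    qed
  qed
  with xy that show thesis by blast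
qed

text \<open>Leaves are peeled off one at a time: the leaf is assigned to its only edge, and the
  remaining edges, which still form a forest, are treated by induction.\<close>

lemma forest_choice_of_endpoints:
  assumes "finite F" and "forest F" and "\<And>e. e \<in> F \<Longrightarrow> card e = 2"
  shows "\<exists>h. inj_on h F \<and> (\<forall>e\<in>F. h e \<in> e)"
  using assms
proof (induction "card F" arbitrary: F)
  case 0
  then show ?case by simp
next
  case (Suc n)
  from Suc.hyps(2) have "F \<noteq> {}" by auto
  then obtain v e where ve: "e \<in> F" "v \<in> e" "\<And>e'. e' \<in> F \<Longrightarrow> v \<in> e' \<Longrightarrow> e' = e"
    using forest_has_leaf[of F] Suc.prems by metis
  have "\<exists>h. inj_on h (F - {e}) \<and> (\<forall>e\<in>F - {e}. h e \<in> e)"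
  proof (rule Suc.hyps(1))
    show "n = card (F - {e})" using Suc.hyps(2) ve(1) by simp
    show "forest (F - {e})" using Suc.prems(2) forest_mono by blast
  qed (use Suc.prems in auto)
  then obtain h where h: "inj_on h (F - {e})" "\<forall>e\<in>F - {e}. h e \<in> e" by blast
  have "inj_on (h(e := v)) F" using h ve
    unfolding inj_on_def by (metis DiffI fun_upd_apply singletonD)
  moreover have "\<forall>e'\<in>F. (h(e := v)) e' \<in> e'" using h(2) ve(2) by auto
  ultimately show ?case by blast
qed

text \<open>The smaller weight on an edge is at most the weight of its chosen endpoint, and
  injectivity of the choice counts every vertex at most once.\<close>

lemma forest_sum_Min_le:
  fixes d :: "'a \<Rightarrow> nat"
  assumes "forest F" and "finite V" and "\<And>e. e \<in> F \<Longrightarrow> e \<subseteq> V \<and> card e = 2"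
  shows "(\<Sum>e\<in>F. Min (d ` e)) \<le> sum d V"
proof -
  have "F \<subseteq> Pow V" using assms(3) by blast
  with assms(2) have "finite F" using finite_subset by blast
  with assms obtain h where h: "inj_on h F" "\<forall>e\<in>F. h e \<in> e"
    using forest_choice_of_endpoints[of F] by blast
  have "Min (d ` e) \<le> d (h e)" if "e \<in> F" for e
    using that h(2) assms(2,3) by (meson Min_le finite_imageI finite_subset imageI)
  then have "(\<Sum>e\<in>F. Min (d ` e)) \<le> (\<Sum>e\<in>F. d (h e))" by (rule sum_mono)
  also have "\<dots> = sum d (h ` F)" by (simp add: sum.reindex[OF h(1)])
  also have "\<dots> \<le> sum d V" using h(2) assms(2,3) by (intro sum_mono2) auto
  finally show ?thesis .
qed

section \<open>Decomposing a graph into forests\<close>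

lemma forest_singleton: "forest {e}"
proof -
  have False if "is_cycle {e} vs" for vs
  proof -
    from that have 3: "3 \<le> length vs" and "distinct vs"
      and edge: "\<And>i. i < length vs \<Longrightarrow> {vs ! i, vs ! (Suc i mod length vs)} = e"
      by (auto simp: is_cycle_def)
    from 3 have "{vs ! 0, vs ! 1} = e" "{vs ! 1, vs ! 2} = e"
      using edge[of 0] edge[of 1] by (simp_all add: numeral_2_eq_2 flip: length_greater_0_conv)
    \<comment> \<open>The first two edges of the cycle coincide and share \<open>vs ! 1\<close>, so
      their other ends agree.\<close>
    then have "vs ! 0 = vs ! 2" by (metis doubleton_eq_iff)
    with 3 \<open>distinct vs\<close> show False 
      using nth_eq_iff_index_eq[of vs 0 2] by force
  qed
  then show ?thesis by (auto simp: forest_def)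
qed

text \<open>A \<open>LEAST\<close> is attained only if some number qualifies; using one forest per
  edge shows that \<open>card E\<close> does.\<close>

lemma arboricity_decomposition:
  fixes E :: "'a set set"
  assumes "finite E"
  shows "\<exists>F :: nat \<Rightarrow> 'a set set. (\<forall>i<arboricity E. forest (F i)) \<and>
    (\<forall>i<arboricity E. \<forall>j<arboricity E. i \<noteq> j \<longrightarrow> F i \<inter> F j = {}) \<and>
    (\<Union>i<arboricity E. F i) = E" (is "?P (arboricity E)")
proof -
  obtain f where f: "bij_betw f {..<card E} E"
    using ex_bij_betw_nat_finite[OF assms] by (auto simp: atLeast0LessThan)
  have "(\<Union>i<card E. {f i}) = E" using f by (simp add: bij_betw_def UNION_singleton_eq_range)
  moreover have "{f i} \<inter> {f j} = {}" if "i < card E" "j < card E" "i \<noteq> j" for i j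
    using f that by (auto simp: bij_betw_def inj_on_def)
  ultimately have "?P (card E)"
    by (intro exI[of _ "\<lambda>i. {f i}"]) (simp add: forest_singleton)
  then show "?P (arboricity E)" unfolding arboricity_def by (rule LeastI[of ?P])
qed

lemma sum_Min_le_arboricity:
  fixes d :: "'a \<Rightarrow> nat"
  assumes "simple_graph V E"
  shows "(\<Sum>e\<in>E. Min (d ` e)) \<le> arboricity E * sum d V"
proof -
  have V: "finite V" and E: "\<And>e. e \<in> E \<Longrightarrow> e \<subseteq> V \<and> card e = 2"
    using assms by (auto simp: simple_graph_def)
  then have "E \<subseteq> Pow V" by blast
  with V have "finite E" using finite_subset by blast
  from arboricity_decomposition[OF this] obtain F
    where F: "\<forall>i<arboricity E. forest (F i)"
      "\<forall>i<arboricity E. \<forall>j<arboricity E. i \<noteq> j \<longrightarrow> F i \<inter> F j = {}"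
      "(\<Union>i<arboricity E. F i) = E" by auto
  have "finite (F i)" if "i < arboricity E" for i
    using F(3) \<open>finite E\<close> that by (auto intro: finite_subset)
  then have "(\<Sum>e\<in>E. Min (d ` e)) = (\<Sum>i<arboricity E. \<Sum>e\<in>F i. Min (d ` e))"
    using sum.UNION_disjoint[of "{..<arboricity E}" F "\<lambda>e. Min (d ` e)"] F(2,3) by simp
  also have "\<dots> \<le> (\<Sum>i<arboricity E. sum d V)"
  proof (intro sum_mono forest_sum_Min_le)
    fix i e assume "i \<in> {..<arboricity E}" "e \<in> F i"
    with F(3) E show "e \<subseteq> V \<and> card e = 2" by blast
  qed (use F(1) V in auto)
  finally show ?thesis by simp
qed

section \<open>Operation counts of leapfrog joins\<close>

text \<open>A move swaps the two iterators, so the recursion stays within pairs and the inductions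
  below need no longer lists.\<close>

lemma leapfrog_search_pair:
  "leapfrog_search [A, B] =
    (if rest A = [] \<or> rest B = [] then ([], [])
     else if iter_key A < iter_key B then
       let A' = iter_seek A (iter_key B) in
       add_opers [Key A, Key B, Seek A (iter_key B), At_End A'] (leapfrog_search [B, A'])
     else
       let A' = iter_next A in
       add_opers [Key A, Key B, Report (iter_key A), Next A, At_End A']
         (add_result (iter_key A) (leapfrog_search [B, A'])))"
  by (simp add: leapfrog_search.simps[of "[A, B]"] iter_at_end_def Let_def)

text \<open>The third hypothesis is the cyclic order invariant: the iterator in front has the
  smaller key. A seek restores it by reaching its target, a next by strict sortedness. Inclusion in
  the intersection is enough for bounding the loops from above.\<close>

lemma leapfrog_search_results:
  assumes "sorted_wrt (<) (rest A)" and "sorted_wrt (<) (rest B)"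
    and "rest A \<noteq> [] \<Longrightarrow> rest B \<noteq> [] \<Longrightarrow> iter_key A \<le> iter_key B"
  shows "distinct (fst (leapfrog_search [A, B])) \<and>
    set (fst (leapfrog_search [A, B])) \<subseteq> set (rest A) \<inter> set (rest B)"
  using assms
proof (induction "length (rest A) + length (rest B)" arbitrary: A B rule: less_induct)
  case less
  show ?case
  proof (cases "rest A = [] \<or> rest B = []")
    case True
    then show ?thesis by (auto simp: leapfrog_search_pair[of A B])
  next
    case False
    then obtain x xs y ys where r: "rest A = x # xs" "rest B = y # ys" by (meson list.exhaust)
    with less.prems have le: "x \<le> y" by (simp add: iter_key_def)
    show ?thesis
    proof (cases "x < y")
      case True
      let ?A = "iter_seek A y"
      have rA: "rest ?A = dropWhile (\<lambda>v. v < y) xs" using r True by (simp add: iter_seek_def)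
      have sub: "set (rest ?A) \<subseteq> set xs" unfolding rA by (meson set_dropWhileD subsetI)
      have "distinct (fst (leapfrog_search [B, ?A])) \<and>
          set (fst (leapfrog_search [B, ?A])) \<subseteq> set (rest B) \<inter> set (rest ?A)"
      proof (rule less.hyps)
        show "length (rest B) + length (rest ?A) < length (rest A) + length (rest B)"
          using length_dropWhile_le[of "\<lambda>v. v < y" xs] by (simp add: r rA)
        show "sorted_wrt (<) (rest ?A)"
          using less.prems(1) unfolding rA r by (simp add: sorted_wrt_dropWhile)
        show "iter_key B \<le> iter_key ?A" if "rest ?A \<noteq> []"
          using that hd_dropWhile[of "\<lambda>v. v < y" xs] by (simp add: iter_key_def r rA)
      qed (use less.prems in simp)
      with False r True sub show ?thesis
        by (auto simp: leapfrog_search_pair[of A B] iter_key_def Let_def add_opers_def)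
    next
      case nless: False
      with le have [simp]: "y = x" by simp
      let ?A = "iter_next A"
      have rA: "rest ?A = xs" using r by (simp add: iter_next_def)
      have "distinct (fst (leapfrog_search [B, ?A])) \<and>
          set (fst (leapfrog_search [B, ?A])) \<subseteq> set (rest B) \<inter> set (rest ?A)"
        using less.prems 
        by (intro less.hyps) (auto simp: r rA iter_key_def less_imp_le)
      \<comment> \<open>All later results lie in \<open>xs\<close>, hence \<open>x\<close> is not
        reported again.\<close>
      moreover have "x \<notin> set xs" using less.prems(1) r by auto
      ultimately show ?thesis using False r
        by (auto simp: leapfrog_search_pair[of A B] iter_key_def Let_def add_opers_def add_result_def rA)
    qed
  qed
qed

text \<open>A move costs at most five operations, consumes a key and passes the turn to the other
  iterator. The bound is asymmetric so as to survive the swap: with \<open>a\<close> and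
  \<open>b\<close> keys left, \<open>min (2 * b) (2 * (a - 1) + 1) + 1\<close> equals
  \<open>min (2 * a) (2 * b + 1)\<close> for positive \<open>a\<close>.\<close>

lemma leapfrog_search_length:
  "length (snd (leapfrog_search [A, B])) \<le>
    5 * min (2 * length (rest A)) (2 * length (rest B) + 1)"
proof (induction "length (rest A) + length (rest B)" arbitrary: A B rule: less_induct)
  case less
  show ?case
  proof (cases "rest A = [] \<or> rest B = []")
    case True
    then show ?thesis by (auto simp: leapfrog_search_pair[of A B])
  next
    case False
    then obtain x xs y ys where r: "rest A = x # xs" "rest B = y # ys" by (meson list.exhaust)
    have step: "length (snd (leapfrog_search [B, A'])) + 5 \<le>
        5 * min (2 * length (rest A)) (2 * length (rest B) + 1)"
      if "length (rest A') \<le> length xs" for A'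
    proof -
      have "length (snd (leapfrog_search [B, A'])) \<le>
          5 * min (2 * length (rest B)) (2 * length (rest A') + 1)"
        using that r by (intro less.hyps) simp
      also have "\<dots> + 5 \<le> 5 * min (2 * length (rest A)) (2 * length (rest B) + 1)"
        using that r by (simp add: min_def)
      finally show ?thesis by simp
    qed
    have "length (rest (iter_next A)) \<le> length xs" using r by (simp add: iter_next_def)
    note next_step = step[OF this]
    show ?thesis
    proof (cases "x < y")
      case True
      have "length (rest (iter_seek A y)) \<le> length xs"
        using r True length_dropWhile_le[of "\<lambda>v. v < y" xs] by (simp add: iter_seek_def)
      from step[OF this] False r True show ?thesis
        by (simp add: leapfrog_search_pair[of A B] iter_key_def Let_def add_opers_def)
    next
      case nless: False
      with next_step False r show ?thesis
        by (simp add: leapfrog_search_pair[of A B] iter_key_def Let_def add_opers_def add_result_def)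
    qed
  qed
qed

text \<open>The constant 11 consists of six operations for opening, testing and reading two
  iterators, and of the 5 by which the search may exceed ten times the smaller size.\<close>

lemma leapfrog_join_pair:
  assumes "finite S" and "finite T"
  shows leapfrog_join_distinct: "distinct (fst (leapfrog_join [S, T]))"
    and leapfrog_join_subset: "set (fst (leapfrog_join [S, T])) \<subseteq> S \<inter> T"
    and leapfrog_join_length:
      "length (snd (leapfrog_join [S, T])) \<le> 11 + 10 * min (card S) (card T)"
proof -
  let ?A = "iter_open S" and ?B = "iter_open T"
  have r: "set (rest ?A) = S" "set (rest ?B) = T" "length (rest ?A) = card S"
    "length (rest ?B) = card T" "sorted_wrt (<) (rest ?A)" "sorted_wrt (<) (rest ?B)"
    using assms by (auto simp: iter_open_def)
  have len: "length (snd (leapfrog_search [?A, ?B])) \<le> 5 + 10 * min (card S) (card T)"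
    "length (snd (leapfrog_search [?B, ?A])) \<le> 5 + 10 * min (card S) (card T)"
    using leapfrog_search_length[of ?A ?B] leapfrog_search_length[of ?B ?A] r(3,4)
    by (auto simp: min_def split: if_splits)
  have "distinct (fst (leapfrog_join [S, T])) \<and> set (fst (leapfrog_join [S, T])) \<subseteq> S \<inter> T \<and>
    length (snd (leapfrog_join [S, T])) \<le> 11 + 10 * min (card S) (card T)"
  \<comment> \<open>The case tells in which order \<open>sort_key\<close>, being stable, leaves the
    iterators. For an empty set the key is an unspecified \<open>hd []\<close>, but then the join
    ends before sorting.\<close>
  proof (cases "iter_key ?A \<le> iter_key ?B")
    case True
    with leapfrog_search_results[of ?A ?B] len r show ?thesis
      by (auto simp: leapfrog_join_def Let_def add_opers_def)
  next
    case False
    with leapfrog_search_results[of ?B ?A] len r show ?thesis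
      by (auto simp: leapfrog_join_def Let_def add_opers_def)
  qed
  then show "distinct (fst (leapfrog_join [S, T]))"
    and "set (fst (leapfrog_join [S, T])) \<subseteq> S \<inter> T"
    and "length (snd (leapfrog_join [S, T])) \<le> 11 + 10 * min (card S) (card T)" by auto
qed

section \<open>Sizes of the sets on which operations act\<close>

fun oper_size :: "'a oper \<Rightarrow> nat" where
  "oper_size (Open A) = iter_size A"
| "oper_size (At_End A) = iter_size A"
| "oper_size (Key A) = iter_size A"
| "oper_size (Next A) = iter_size A"
| "oper_size (Seek A x) = iter_size A"
| "oper_size (Report x) = 0"
| "oper_size (Output t) = 0"

text \<open>Seek and next change only \<open>rest\<close>; \<open>keys\<close>, and with it
  \<open>iter_size\<close>, is invariant.\<close>

lemma leapfrog_search_oper_size: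
  assumes "\<And>A. A \<in> set its \<Longrightarrow> iter_size A \<le> M" and "op \<in> set (snd (leapfrog_search its))"
  shows "oper_size op \<le> M"
  using assms
proof (induction its rule: leapfrog_search.induct)
  case (1 its)
  show ?case
  proof (cases "its = [] \<or> (\<exists>A\<in>set its. iter_at_end A)")
    case True
    with "1.prems"(2) show ?thesis by (simp add: leapfrog_search.simps[of its])
  next
    case False
    let ?x = "iter_key (hd its)" and ?y = "iter_key (last its)"
    from False have size: "iter_size (hd its) \<le> M" "iter_size (last its) \<le> M"
      "\<And>A. A \<in> set (tl its) \<Longrightarrow> iter_size A \<le> M"
      using "1.prems"(1) by (auto dest: list.set_sel(2))
    show ?thesis
    proof (cases "?x < ?y")
      case True
      have "iter_size (iter_seek (hd its) ?y) \<le> M"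
        using size by (simp add: iter_size_def iter_seek_def)
      with "1.IH"(1)[OF False refl refl refl refl True refl] "1.prems"(2) size False True
      show ?thesis
        by (auto simp: leapfrog_search.simps[of its] Let_def add_opers_def)
    next
      case nless: False
      have "iter_size (iter_next (hd its)) \<le> M"
        using size by (simp add: iter_size_def iter_next_def)
      with "1.IH"(2)[OF False refl refl refl refl nless refl] "1.prems"(2) size False nless
      show ?thesis
        by (auto simp: leapfrog_search.simps[of its] Let_def add_opers_def add_result_def)
    qed
  qed
qed

lemma leapfrog_join_oper_size:
  assumes "\<And>S. S \<in> set Ss \<Longrightarrow> card S \<le> M" and "op \<in> set (snd (leapfrog_join Ss))"
  shows "oper_size op \<le> M"
proof -
  have "iter_size A \<le> M" if "A \<in> iter_open ` set Ss" for A
    using that assms(1) by (auto simp: iter_size_def iter_open_def)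
  with assms(2) show ?thesis
    by (auto simp: leapfrog_join_def Let_def add_opers_def split: if_splits
        intro: leapfrog_search_oper_size[rotated])
qed

section \<open>Operation count of the triangle query\<close>

text \<open>Distinct loop values turn the sum over a list into a sum over a set, which may then be
  enlarged to \<open>S\<close>.\<close>

lemma for_each_length_le:
  assumes "distinct (fst r)" and "set (fst r) \<subseteq> S" and "finite S"
    and "\<And>x. x \<in> S \<Longrightarrow> length (snd (body x)) \<le> g x"
  shows "length (snd (for_each r body)) \<le> length (snd r) + sum g S"
proof -
  have "length (snd (for_each r body)) = length (snd r) + (\<Sum>x\<in>set (fst r). length (snd (body x)))"
    using assms(1) by (simp add: for_each_def length_concat comp_def sum_list_distinct_conv_sum_set)
  also have "(\<Sum>x\<in>set (fst r). length (snd (body x))) \<le> (\<Sum>x\<in>set (fst r). g x)"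
    using assms(2,4) by (intro sum_mono) auto
  also have "\<dots> \<le> sum g S" using assms(2,3) by (intro sum_mono2) auto
  finally show ?thesis by simp
qed

lemma set_snd_for_each:
  "set (snd (for_each r body)) = set (snd r) \<union> (\<Union>x\<in>set (fst r). set (snd (body x)))"
  by (simp add: for_each_def)

section \<open>Source and successor sets, and nested loops as sums over edges\<close>

lemma finite_sources: "finite E \<Longrightarrow> finite (sources E)"
  and card_sources_le: "finite E \<Longrightarrow> card (sources E) \<le> card E"
proof -
  have "sources E = fst ` E" by (force simp: sources_def)
  then show "finite E \<Longrightarrow> finite (sources E)" "finite E \<Longrightarrow> card (sources E) \<le> card E"
    by (simp_all add: card_image_le)
qed

lemma finite_successors: "finite E \<Longrightarrow> finite (successors E a)"
  and card_successors_le: "finite E \<Longrightarrow> card (successors E a) \<le> card E"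
proof -
  have sub: "successors E a \<subseteq> snd ` E" by (force simp: successors_def)
  then show "finite E \<Longrightarrow> finite (successors E a)" by (meson finite_imageI finite_subset)
  show "finite E \<Longrightarrow> card (successors E a) \<le> card E"
    by (meson card_image_le card_mono finite_imageI le_trans sub)
qed

lemma Sigma_sources_successors: "Sigma (sources E) (successors E) = E"
  by (auto simp: sources_def successors_def)

lemma sum_over_successors:
  assumes "finite E"
  shows "(\<Sum>a\<in>sources E. \<Sum>b\<in>successors E a. f a b) = (\<Sum>(a, b)\<in>E. f a b)"
  using sum.Sigma[of "sources E" "successors E" f] assms
  by (simp add: finite_sources finite_successors Sigma_sources_successors)

text \<open>The middle joins are charged to the successor sets, whose sizes add up to
  \<open>card E\<close>; only the innermost joins contribute the sum of minima.\<close>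

lemma lftj_triangle_length:
  assumes "finite E"
  shows "length (snd (lftj_triangle E)) \<le> 11 + 42 * card E +
    11 * (\<Sum>(a, b)\<in>E. min (card (successors E a)) (card (successors E b)))"
proof -
  let ?S = "sources E" and ?D = "successors E"
  let ?min = "\<lambda>a b. min (card (?D a)) (card (?D b))"
  note fin = finite_sources[OF assms] finite_successors[OF assms]
  define inner where "inner a b =
    for_each (leapfrog_join [?D a, ?D b]) (\<lambda>c. ([(a, b, c)], [Output (a, b, c)]))" for a b
  define mid where "mid a = for_each (leapfrog_join [?S, ?D a]) (inner a)" for a
  \<comment> \<open>Ten operations per element of the smaller set come from the join and one more
    from the \<open>Output\<close> of each result.\<close>
  have inner: "length (snd (inner a b)) \<le> 11 + 11 * ?min a b" for a b
  proof -
    have "length (snd (inner a b)) \<le>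
        length (snd (leapfrog_join [?D a, ?D b])) + (\<Sum>c\<in>?D a \<inter> ?D b. 1)"
      unfolding inner_def using fin
      by (intro for_each_length_le leapfrog_join_distinct leapfrog_join_subset) auto
    moreover have "card (?D a \<inter> ?D b) \<le> ?min a b" by (simp add: card_mono fin)
    ultimately show ?thesis using leapfrog_join_length[of "?D a" "?D b"] fin
      by (simp del: min.bounded_iff)
  qed
  have mid: "length (snd (mid a)) \<le> 11 + 10 * card (?D a) + (\<Sum>b\<in>?D a. 11 + 11 * ?min a b)" for a
  proof -
    have "length (snd (mid a)) \<le>
        length (snd (leapfrog_join [?S, ?D a])) + (\<Sum>b\<in>?D a. 11 + 11 * ?min a b)"
      unfolding mid_def using fin leapfrog_join_subset[of ?S "?D a"]
      by (intro for_each_length_le leapfrog_join_distinct inner) auto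
    then show ?thesis using leapfrog_join_length[of ?S "?D a"] fin
      by (simp add: min_def split: if_splits)
  qed
  have card_E: "(\<Sum>a\<in>?S. card (?D a)) = card E"
    using sum_over_successors[OF assms, of "\<lambda>_ _. 1::nat"] by (simp add: case_prod_unfold)
  have "length (snd (lftj_triangle E)) \<le> length (snd (leapfrog_join [?S, ?S])) +
      (\<Sum>a\<in>?S. 11 + 10 * card (?D a) + (\<Sum>b\<in>?D a. 11 + 11 * ?min a b))"
    unfolding lftj_triangle_def inner_def[symmetric] mid_def[symmetric]
    using fin leapfrog_join_subset[of ?S ?S]
    by (intro for_each_length_le leapfrog_join_distinct mid) auto
  also have "(\<Sum>a\<in>?S. 11 + 10 * card (?D a) + (\<Sum>b\<in>?D a. 11 + 11 * ?min a b)) =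
      11 * card ?S + 10 * (\<Sum>a\<in>?S. card (?D a)) + 11 * (\<Sum>a\<in>?S. card (?D a)) +
      11 * (\<Sum>a\<in>?S. \<Sum>b\<in>?D a. ?min a b)"
    by (simp add: sum.distrib flip: sum_distrib_left)
  also have "\<dots> = 11 * card ?S + 21 * card E + 11 * (\<Sum>(a, b)\<in>E. ?min a b)"
    by (simp add: card_E sum_over_successors[OF assms])
  \<comment> \<open>The outermost join adds \<open>11 + 10 * card ?S\<close>. With
    \<open>card ?S \<le> card E\<close>, the coefficients 10 + 11 of \<open>card ?S\<close> and 21
    of \<open>card E\<close> give 42.\<close>
  finally show ?thesis
    using leapfrog_join_length[of ?S ?S] fin card_sources_le[OF assms] by simp
qed

lemma lftj_triangle_oper_size:
  assumes "finite E" and "op \<in> set (snd (lftj_triangle E))"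
  shows "oper_size op \<le> card E"
proof -
  have join: "oper_size op' \<le> card E"
    if "op' \<in> set (snd (leapfrog_join [S, T]))"
      and "S \<in> insert (sources E) (range (successors E))"
      and "T \<in> insert (sources E) (range (successors E))" for op' S T
    using that card_sources_le[OF assms(1)] card_successors_le[OF assms(1)]
    by (intro leapfrog_join_oper_size[of "[S, T]"]) auto
  from assms(2) show ?thesis
    by (auto simp: lftj_triangle_def set_snd_for_each intro: join)
qed

section \<open>Running time\<close>

lemma simple_graph_endpoints:
  assumes "simple_graph V E"
  shows inj_on_Min_Max: "inj_on (\<lambda>e. (Min e, Max e)) E"
    and edge_eq_Min_Max: "e \<in> E \<Longrightarrow> {Min e, Max e} = e"
proof -
  have ends: "{Min e, Max e} = e" if "e \<in> E" for e
  proof -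
    from that assms have "card e = 2" by (simp add: simple_graph_def)
    then obtain x y where "e = {x, y}" by (metis card_2_iff)
    then show ?thesis by (auto simp: min_def max_def)
  qed
  then show "e \<in> E \<Longrightarrow> {Min e, Max e} = e" .
  show "inj_on (\<lambda>e. (Min e, Max e)) E" 
    by (rule inj_on_inverseI[where g = "\<lambda>(a, b). {a, b}"]) (simp add: ends)
qed

lemma sum_min_successors_le:
  assumes "simple_graph V E"
  shows "(\<Sum>(a, b)\<in>directed E.
      min (card (successors (directed E) a)) (card (successors (directed E) b))) \<le> arboricity E * card E"
proof -
  let ?d = "\<lambda>v. card (successors (directed E) v)"
  have V: "finite V" and "E \<subseteq> Pow V" using assms by (auto simp: simple_graph_def)
  then have "finite E" using finite_subset by blast
  then have fin: "finite (directed E)" by (simp add: directed_def)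
  have "sources (directed E) \<subseteq> V"
    using \<open>E \<subseteq> Pow V\<close> edge_eq_Min_Max[OF assms] by (auto simp: sources_def directed_def)
  \<comment> \<open>Vertices that are not sources have no successors and thus weight 0.\<close>
  then have "sum ?d V = sum ?d (sources (directed E))"
    using V by (intro sum.mono_neutral_right) (auto simp: sources_def successors_def)
  also have "\<dots> = card (directed E)"
    using sum_over_successors[OF fin, of "\<lambda>_ _. 1::nat"] by (simp add: case_prod_unfold)
  also have "\<dots> = card E" unfolding directed_def by (rule card_image[OF inj_on_Min_Max[OF assms]])
  finally have total: "sum ?d V = card E" .
  have Min_eq: "Min (?d ` e) = min (?d (Min e)) (?d (Max e))" if "e \<in> E" for e
  proof -
    have "?d ` e = {?d (Min e), ?d (Max e)}"
      by (subst edge_eq_Min_Max[OF assms that, symmetric]) simp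
    then show ?thesis by simp
  qed
  have "sum f (directed E) = (\<Sum>e\<in>E. f (Min e, Max e))" for f :: "'a \<times> 'a \<Rightarrow> nat"
    unfolding directed_def by (simp add: sum.reindex[OF inj_on_Min_Max[OF assms]])
  then have "(\<Sum>(a, b)\<in>directed E. min (?d a) (?d b)) = (\<Sum>e\<in>E. min (?d (Min e)) (?d (Max e)))"
    by simp
  also have "\<dots> = (\<Sum>e\<in>E. Min (?d ` e))" by (intro sum.cong) (simp_all add: Min_eq)
  also have "\<dots> \<le> arboricity E * sum ?d V" by (rule sum_Min_le_arboricity[OF assms])
  finally show ?thesis by (simp add: total)
qed

text \<open>From \<open>m = 2\<close> on, \<open>log 2 m\<close> is at least 1, so twice this
  logarithm absorbs both constants and the summand 1 in the logarithmic bounds.\<close>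

lemma iterator_costs_bound:
  assumes "iterator_costs cost"
  obtains c :: real where "0 \<le> c"
    and "\<And>op m. 2 \<le> m \<Longrightarrow> oper_size op \<le> m \<Longrightarrow> real (cost op) \<le> c * log 2 (real m)"
proof -
  from assms obtain c :: real where c: "\<And>A. real (cost (At_End A)) \<le> c"
    "\<And>A. real (cost (Key A)) \<le> c" "\<And>x. real (cost (Report x)) \<le> c"
    "\<And>t. real (cost (Output t)) \<le> c"
    "\<And>A. real (cost (Open A)) \<le> c * (1 + log 2 (real (iter_size A)))"
    "\<And>A. real (cost (Next A)) \<le> c * (1 + log 2 (real (iter_size A)))"
    "\<And>A x. real (cost (Seek A x)) \<le> c * (1 + log 2 (real (iter_size A)))"
    unfolding iterator_costs_def by blast
  have "0 \<le> c" using c(1) of_nat_0_le_iff order_trans by blast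
  have "real (cost op) \<le> 2 * c * log 2 (real m)" if m: "2 \<le> m" "oper_size op \<le> m" for op m
  proof -
    \<comment> \<open>By this default value the monotone estimate below also covers empty
      sets.\<close>
    have log_zero: "log 2 (0::real) = 0" by (simp add: log_def)
    have one: "1 \<le> log 2 (real m)" using m by simp
    have size: "c * (1 + log 2 (real n)) \<le> 2 * c * log 2 (real m)" if "n \<le> m" for n
    proof -
      have "log 2 (real n) \<le> log 2 (real m)"
        using that m one log_zero by (cases "n = 0") simp_all
      with one have "1 + log 2 (real n) \<le> 2 * log 2 (real m)" by simp
      from mult_left_mono[OF this \<open>0 \<le> c\<close>] show ?thesis by (simp add: mult_ac)
    qed
    \<comment> \<open>At size 1 the logarithm vanishes and the bound is \<open>c\<close>
      itself.\<close>
    from size[of 1] m have const: "c \<le> 2 * c * log 2 (real m)" by simp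
    from m(2) show ?thesis
      by (cases op) (simp_all add: c(1-4)[THEN order_trans[OF _ const]]
          c(5-7)[THEN order_trans[OF _ size]])
  qed
  with \<open>0 \<le> c\<close> that[of "2 * c"] show thesis by simp
qed

lemma lftj_time_le:
  assumes "finite E" and "\<And>op. oper_size op \<le> card E \<Longrightarrow> real (cost op) \<le> B"
  shows "real (lftj_time cost E) \<le> real (length (snd (lftj_triangle E))) * B"
proof -
  have "real (sum_list (map cost ops)) \<le> real (length ops) * B"
    if "\<And>op. op \<in> set ops \<Longrightarrow> real (cost op) \<le> B" for ops
    using that by (induction ops) (force simp: algebra_simps)+
  then show ?thesis
    unfolding lftj_time_def using assms lftj_triangle_oper_size by blast
qed

text \<open>One constant serves all \<open>m\<close> and all graphs. The condition
  \<open>1 \<le> \<alpha> m\<close> lets \<open>m * \<alpha> m\<close> dominate the linear part of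
  the operation count, and \<open>2 \<le> m\<close> keeps the logarithm at 1 or more.\<close>

theorem theorem17:
  fixes \<alpha> :: "nat \<Rightarrow> nat"
    and cost :: "'a::linorder oper \<Rightarrow> nat"
  assumes "mono \<alpha>"
    and "iterator_costs cost"
  shows "\<exists>C::real. \<forall>m\<ge>2. 1 \<le> \<alpha> m \<longrightarrow>
    (\<forall>(V :: 'a set) (E :: 'a set set).
       simple_graph V E \<and> card E \<le> m \<and> arboricity E \<le> \<alpha> m \<longrightarrow>
       real (lftj_time cost (directed E)) \<le> C * (real m * real (\<alpha> m) * log 2 (real m)))"
proof -
  obtain c :: real where c: "0 \<le> c"
    "\<And>op m. 2 \<le> m \<Longrightarrow> oper_size op \<le> m \<Longrightarrow> real (cost op) \<le> c * log 2 (real m)"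
    using iterator_costs_bound[OF assms(2)] by blast
  show ?thesis
  \<comment> \<open>The factor is 64 = 11 + 42 + 11: each of the three terms of the operation count
    is at most its coefficient times \<open>\<alpha> m * m\<close>.\<close>
  proof (rule exI[of _ "64 * c"], intro allI impI, elim conjE)
    fix m :: nat and V :: "'a set" and E :: "'a set set"
    assume m: "2 \<le> m" and \<alpha>: "1 \<le> \<alpha> m" and G: "simple_graph V E"
      and card: "card E \<le> m" and arb: "arboricity E \<le> \<alpha> m"
    from G have "finite V" "E \<subseteq> Pow V" by (auto simp: simple_graph_def)
    then have "finite E" using finite_subset by blast
    then have fin: "finite (directed E)" by (simp add: directed_def)
    have card_dir: "card (directed E) = card E"
      unfolding directed_def by (rule card_image[OF inj_on_Min_Max[OF G]])
    have "arboricity E * card E \<le> \<alpha> m * m" using arb card by (rule mult_le_mono)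
    moreover have "m \<le> \<alpha> m * m" using \<alpha> by simp
    ultimately have len: "length (snd (lftj_triangle (directed E))) \<le> 64 * (\<alpha> m * m)"
      using lftj_triangle_length[OF fin] sum_min_successors_le[OF G] card m
      unfolding card_dir by linarith
    have "real (lftj_time cost (directed E)) \<le>
        real (length (snd (lftj_triangle (directed E)))) * (c * log 2 (real m))"
      using c(2)[OF m] card card_dir by (intro lftj_time_le fin) simp
    also have "\<dots> \<le> real (64 * (\<alpha> m * m)) * (c * log 2 (real m))"
      using len c(1) m by (intro mult_right_mono) (simp_all only: of_nat_le_iff, simp)
    finally show "real (lftj_time cost (directed E)) \<le>
        64 * c * (real m * real (\<alpha> m) * log 2 (real m))" by (simp add: mult_ac)
  qed
qed

end
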